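(* For any non-empty hypersequent $\mathcal{G}$, $\mathcal{G}$ is valid in the variety $\mathcal{A}$ of abelian $\ell$-groups if and only if $\mathcal{G}$ is derivable in the hypersequent calculus $\mathrm{GA}$.
   Context: A literal is a variable $x$ or its inverse $x^{-1}$; set $\overline{x}=x^{-1}$ and $\overline{x^{-1}}=x$. A sequent $\Gamma$ is a finite sequence of literals $\ell_1,\ldots,\ell_n$, with inverse $\overline{\Gamma}=\overline{\ell_n},\ldots,\overline{\ell_1}$; it is identified with the group term $\ell_1\cdots\ell_n$ (and with $e$ if $n=0$). A hypersequent is a finite set of sequents, written $\Gamma_1\mid\ldots\mid\Gamma_n$; a non-empty hypersequent is identified with the $\ell$-group term $\Gamma_1\lor\dots\lor\Gamma_n$. A non-empty hypersequent $\mathcal{G}$ is valid in a class $\mathcal{K}$ of $\ell$-groups if $e \le \mathcal{G}$ holds in every member of $\mathcal{K}$ under every assignment. An $\ell$-group is an algebra $\langle L,\land,\lor,\cdot,{}^{-1},e\rangle$ that is a group and a lattice with $a\le b \Rightarrow cad\le cbd$; abelian if $\cdot$ is commutative. Below $\mathcal{G}\mid\Gamma$ denotes $\mathcal{G}\cup\{\Gamma\}$ for an arbitrary (possibly empty) hypersequent $\mathcal{G}$, and $\Gamma,\Delta$ denotes concatenation. The calculus $\mathrm{GA}$ has the rules: (id) with no premises and conclusion $\mathcal{G}\mid\Delta,\overline{\Delta}$; (ex) from $\mathcal{G}\mid\Pi,\Delta,\Gamma$ infer $\mathcal{G}\mid\Pi,\Gamma,\Delta$; (split) from $\mathcal{G}\mid\Gamma,\Delta$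 infer $\mathcal{G}\mid\Gamma\mid\Delta$. A derivation of $\mathcal{G}$ is a finite tree of hypersequents with root $\mathcal{G}$ in which each node together with its parents (premises) forms an instance of a rule. *)

theory Defs
  imports "HOL-Algebra.Group" "HOL-Algebra.Lattice" "HOL-Library.FSet"
begin

datatype 'v literal = Var 'v | Inv 'v

fun lit_inv :: "'v literal \<Rightarrow> 'v literal" where
  "lit_inv (Var x) = Inv x"
| "lit_inv (Inv x) = Var x"

type_synonym 'v sequent = "'v literal list"

definition seq_inv :: "'v sequent \<Rightarrow> 'v sequent" where
  "seq_inv \<Gamma> = rev (map lit_inv \<Gamma>)"

type_synonym 'v hypersequent = "'v sequent fset"

(* The hypersequent G | \<Gamma> is finsert \<Gamma> G, where G may be empty and may already contain \<Gamma>. *)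
inductive GA :: "'v hypersequent \<Rightarrow> bool" where
  id: "GA (finsert (\<Delta> @ seq_inv \<Delta>) G)"
| ex: "GA (finsert (\<Theta> @ \<Delta> @ \<Gamma>) G) \<Longrightarrow> GA (finsert (\<Theta> @ \<Gamma> @ \<Delta>) G)"
| split: "GA (finsert (\<Gamma> @ \<Delta>) G) \<Longrightarrow> GA (finsert \<Gamma> (finsert \<Delta> G))"

(* The library's group and lattice structures are separate extensions of partial_object,
   so an l-group is a monoid record carrying in addition its lattice order, from which
   lg_order builds the structure the lattice locale expects.  Meet and join are the
   library's operations for that order. *)
record 'g lgroup = "'g monoid" +
  lg_le :: "'g \<Rightarrow> 'g \<Rightarrow> bool"

definition lg_order :: "'g lgroup \<Rightarrow> 'g gorder" where
  "lg_order L = \<lparr>carrier = carrier L, eq = (=), le = lg_le L\<rparr>"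

definition is_lgroup :: "'g lgroup \<Rightarrow> bool" where
  "is_lgroup L \<longleftrightarrow>
     group L \<and> lattice (lg_order L) \<and>
     (\<forall>a\<in>carrier L. \<forall>b\<in>carrier L. \<forall>c\<in>carrier L. \<forall>d\<in>carrier L.
        a \<sqsubseteq>\<^bsub>lg_order L\<^esub> b \<longrightarrow>
        c \<otimes>\<^bsub>L\<^esub> a \<otimes>\<^bsub>L\<^esub> d \<sqsubseteq>\<^bsub>lg_order L\<^esub> c \<otimes>\<^bsub>L\<^esub> b \<otimes>\<^bsub>L\<^esub> d)"

(* The members of the variety whose carrier is a set of elements of 'g.  A finite type 'g
   would leave only trivial l-groups; an infinite one of arbitrary size is what is meant. *)
definition abelian_lgroups :: "'g lgroup set" where
  "abelian_lgroups = {L. is_lgroup L \<and> comm_group L}"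

fun lit_val :: "'g lgroup \<Rightarrow> ('v \<Rightarrow> 'g) \<Rightarrow> 'v literal \<Rightarrow> 'g" where
  "lit_val L h (Var x) = h x"
| "lit_val L h (Inv x) = inv\<^bsub>L\<^esub> (h x)"

fun seq_val :: "'g lgroup \<Rightarrow> ('v \<Rightarrow> 'g) \<Rightarrow> 'v sequent \<Rightarrow> 'g" where
  "seq_val L h [] = \<one>\<^bsub>L\<^esub>"
| "seq_val L h (l # \<Gamma>) = lit_val L h l \<otimes>\<^bsub>L\<^esub> seq_val L h \<Gamma>"

(* The value of the term \<Gamma>1 \<or> ... \<or> \<Gamma>n: the join of the finite set of values of its members.
   Meaningful only for non-empty G. *)
definition hseq_val :: "'g lgroup \<Rightarrow> ('v \<Rightarrow> 'g) \<Rightarrow> 'v hypersequent \<Rightarrow> 'g" where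
  "hseq_val L h G = \<Squnion>\<^bsub>lg_order L\<^esub> (seq_val L h ` fset G)"

definition valid_in :: "'g lgroup set \<Rightarrow> 'v hypersequent \<Rightarrow> bool" where
  "valid_in K G \<longleftrightarrow>
     (\<forall>L\<in>K. \<forall>h. (\<forall>x. h x \<in> carrier L) \<longrightarrow> \<one>\<^bsub>L\<^esub> \<sqsubseteq>\<^bsub>lg_order L\<^esub> hseq_val L h G)"

end

theory Submission
  imports Defs "HOL-Library.Countable" "HOL-Library.Multiset"
begin

text \<open>
  Soundness of (split) reduces to the fact that \<open>e \<le> w \<or> w\<^sup>2\<close> implies \<open>e \<le> w\<close> in every
  \<open>\<ell>\<close>-group: for \<open>q = e \<or> w\<close> the hypothesis says \<open>e \<le> w q\<close>, and \<open>w \<le> w q\<close> always holds, so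
  \<open>q \<le> w q\<close>, and \<open>q\<close> cancels.

  For completeness, a sequent is abstracted to its integer vector of net exponents. If \<open>G\<close> is valid
  in the ordered group of rationals, then no linear functional is negative on all vectors of \<open>G\<close>,
  so by Gordan's alternative (proved by Fourier-Motzkin elimination) some non-empty sum of these
  vectors, with repetitions, vanishes. The corresponding concatenation of sequents is derivable
  by (id) and (ex), and splitting it yields \<open>G\<close>, as repeated sequents are absorbed.
\<close>

section \<open>Soundness\<close>

lemma lg_order_simps [simp]:
  "carrier (lg_order L) = carrier L" "le (lg_order L) = lg_le L" "eq (lg_order L) = (=)"
  by (simp_all add: lg_order_def)

lemma
  assumes "is_lgroup L"
  shows is_lgroup_group: "group L"
    and is_lgroup_lattice: "lattice (lg_order L)"
    and is_lgroup_mult_mono: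
      "\<And>a b c d. \<lbrakk>lg_le L a b; a \<in> carrier L; b \<in> carrier L; c \<in> carrier L; d \<in> carrier L\<rbrakk>
        \<Longrightarrow> lg_le L (c \<otimes>\<^bsub>L\<^esub> a \<otimes>\<^bsub>L\<^esub> d) (c \<otimes>\<^bsub>L\<^esub> b \<otimes>\<^bsub>L\<^esub> d)"
  using assms by (auto simp: is_lgroup_def)

lemma lit_val_closed:
  assumes "group L" "\<And>x. h x \<in> carrier L"
  shows "lit_val L h l \<in> carrier L"
  using assms by (cases l) (auto intro: group.inv_closed)

lemma seq_val_closed:
  assumes "group L" "\<And>x. h x \<in> carrier L"
  shows "seq_val L h \<Gamma> \<in> carrier L"
proof -
  interpret group L by fact
  show ?thesis by (induction \<Gamma>) (auto simp: lit_val_closed assms)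
qed

lemma seq_val_append:
  assumes "group L" "\<And>x. h x \<in> carrier L"
  shows "seq_val L h (\<Gamma> @ \<Delta>) = seq_val L h \<Gamma> \<otimes>\<^bsub>L\<^esub> seq_val L h \<Delta>"
proof -
  interpret group L by fact
  show ?thesis
    by (induction \<Gamma>) (auto simp: lit_val_closed seq_val_closed assms m_assoc)
qed

lemma seq_val_seq_inv:
  assumes "group L" "\<And>x. h x \<in> carrier L"
  shows "seq_val L h (seq_inv \<Gamma>) = inv\<^bsub>L\<^esub> (seq_val L h \<Gamma>)"
proof -
  interpret group L by fact
  have lit: "lit_val L h (lit_inv l) = inv\<^bsub>L\<^esub> (lit_val L h l)" for l
    by (cases l) (auto simp: assms)
  show ?thesis
    by (induction \<Gamma>)
       (auto simp: seq_inv_def seq_val_append[OF assms] lit lit_val_closed seq_val_closed assms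
          inv_mult_group)
qed

text \<open>The join is the least upper bound of the values, so being above \<open>e\<close> can be
  tested on all upper bounds. Both directions of the theorem then argue with upper bounds instead of
  the join itself.\<close>

lemma one_le_hseq_val_iff:
  assumes L: "is_lgroup L" and h: "\<And>x. h x \<in> carrier L" and "G \<noteq> {||}"
  shows "lg_le L \<one>\<^bsub>L\<^esub> (hseq_val L h G) \<longleftrightarrow>
    (\<forall>y\<in>carrier L. (\<forall>\<Gamma>\<in>fset G. lg_le L (seq_val L h \<Gamma>) y) \<longrightarrow> lg_le L \<one>\<^bsub>L\<^esub> y)"
proof -
  interpret group L using L by (rule is_lgroup_group)
  interpret O: lattice "lg_order L" using L by (rule is_lgroup_lattice)
  let ?A = "seq_val L h ` fset G"
  have A: "?A \<subseteq> carrier L" by (auto simp: seq_val_closed h is_group)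
  have "least (lg_order L) (hseq_val L h G) (Upper (lg_order L) ?A)"
    unfolding hseq_val_def using A \<open>G \<noteq> {||}\<close>
    by (intro O.finite_sup_least) (auto simp: fset_eq_iff)
  then have v: "hseq_val L h G \<in> carrier L"
    "\<And>\<Gamma>. \<Gamma> \<in> fset G \<Longrightarrow> lg_le L (seq_val L h \<Gamma>) (hseq_val L h G)"
    "\<And>y. y \<in> carrier L \<Longrightarrow> \<forall>\<Gamma>\<in>fset G. lg_le L (seq_val L h \<Gamma>) y \<Longrightarrow> lg_le L (hseq_val L h G) y"
    using A by (auto simp: least_def Upper_def)
  show ?thesis
    using v O.le_trans[of "\<one>\<^bsub>L\<^esub>" "hseq_val L h G"] by auto
qed

text \<open>\<open>sup\<close> says that \<open>e\<close> lies below the join of \<open>w\<close>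
  and its square, phrased through upper bounds to fit the induction on derivations. It is applied to
  the upper bound \<open>w q\<close>.\<close>

lemma lgroup_one_le_if_one_le_sup_square:
  assumes L: "is_lgroup L" and w: "w \<in> carrier L"
    and sup: "\<And>z. \<lbrakk>z \<in> carrier L; lg_le L w z; lg_le L (w \<otimes>\<^bsub>L\<^esub> w) z\<rbrakk> \<Longrightarrow> lg_le L \<one>\<^bsub>L\<^esub> z"
  shows "lg_le L \<one>\<^bsub>L\<^esub> w"
proof -
  interpret group L using L by (rule is_lgroup_group)
  interpret O: lattice "lg_order L" using L by (rule is_lgroup_lattice)
  note mono = is_lgroup_mult_mono[OF L]
  define q where "q = \<one>\<^bsub>L\<^esub> \<squnion>\<^bsub>lg_order L\<^esub> w"
  have q: "q \<in> carrier L" "lg_le L \<one>\<^bsub>L\<^esub> q" "lg_le L w q"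
    using O.join_closed[of "\<one>\<^bsub>L\<^esub>" w] O.join_left[of "\<one>\<^bsub>L\<^esub>" w] O.join_right[of "\<one>\<^bsub>L\<^esub>" w] w
    by (simp_all add: q_def)
  have 1: "lg_le L w (w \<otimes>\<^bsub>L\<^esub> q)"
    using mono[of "\<one>\<^bsub>L\<^esub>" q w "\<one>\<^bsub>L\<^esub>"] q w by simp
  have 2: "lg_le L (w \<otimes>\<^bsub>L\<^esub> w) (w \<otimes>\<^bsub>L\<^esub> q)"
    using mono[of w q w "\<one>\<^bsub>L\<^esub>"] q w by simp
  have "lg_le L \<one>\<^bsub>L\<^esub> (w \<otimes>\<^bsub>L\<^esub> q)"
    using sup 1 2 q w by simp
  then have "lg_le L q (w \<otimes>\<^bsub>L\<^esub> q)"
    using O.join_le[of "\<one>\<^bsub>L\<^esub>" "w \<otimes>\<^bsub>L\<^esub> q" w] 1 q w by (simp add: q_def)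
  then show ?thesis
    using mono[of q "w \<otimes>\<^bsub>L\<^esub> q" "\<one>\<^bsub>L\<^esub>" "inv\<^bsub>L\<^esub> q"] q w by (simp add: m_assoc)
qed

text \<open>The bound \<open>y\<close> must vary in the induction: at (split) the premise is used
  with a bound other than that of the conclusion.\<close>

lemma GA_sound:
  assumes "GA G" and L: "is_lgroup L" and comm: "comm_group L" and h: "\<And>x. h x \<in> carrier L"
    and "y \<in> carrier L" and "\<forall>\<Gamma>\<in>fset G. lg_le L (seq_val L h \<Gamma>) y"
  shows "lg_le L \<one>\<^bsub>L\<^esub> y"
proof -
  interpret comm_group L by (rule comm)
  interpret O: lattice "lg_order L" using L by (rule is_lgroup_lattice)
  note mono = is_lgroup_mult_mono[OF L]
  have val [simp]: "seq_val L h \<Gamma> \<in> carrier L"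
    "seq_val L h (\<Gamma> @ \<Delta>) = seq_val L h \<Gamma> \<otimes>\<^bsub>L\<^esub> seq_val L h \<Delta>"
    "seq_val L h (seq_inv \<Gamma>) = inv\<^bsub>L\<^esub> (seq_val L h \<Gamma>)" for \<Gamma> \<Delta>
    by (simp_all add: seq_val_closed seq_val_append seq_val_seq_inv is_group h)
  show ?thesis
    using assms(1,5,6)
  proof (induction arbitrary: y rule: GA.induct)
    case (id \<Delta> G)
    then show ?case by simp
  next
    case (ex \<Theta> \<Delta> \<Gamma> G)
    then show ?case by (simp add: m_comm[of "seq_val L h \<Delta>"])
  next
    case (split \<Gamma> \<Delta> G)
    show ?case
    \<comment> \<open>Since \<open>y\<close> bounds both halves, its square bounds their product.
      Hence any \<open>z\<close> above \<open>y\<close> and its square bounds every sequent of the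
      premise.\<close>
    proof (rule lgroup_one_le_if_one_le_sup_square[OF L \<open>y \<in> carrier L\<close>])
      fix z assume z: "z \<in> carrier L" "lg_le L y z" "lg_le L (y \<otimes>\<^bsub>L\<^esub> y) z"
      let ?a = "seq_val L h \<Gamma>" and ?b = "seq_val L h \<Delta>"
      have "lg_le L (?a \<otimes>\<^bsub>L\<^esub> ?b) (y \<otimes>\<^bsub>L\<^esub> ?b)"
        using mono[of ?a y "\<one>\<^bsub>L\<^esub>" ?b] split.prems by simp
      moreover have "lg_le L (y \<otimes>\<^bsub>L\<^esub> ?b) (y \<otimes>\<^bsub>L\<^esub> y)"
        using mono[of ?b y y "\<one>\<^bsub>L\<^esub>"] split.prems by simp
      ultimately have "lg_le L (?a \<otimes>\<^bsub>L\<^esub> ?b) z"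
        using O.le_trans[of "?a \<otimes>\<^bsub>L\<^esub> ?b" "y \<otimes>\<^bsub>L\<^esub> ?b" "y \<otimes>\<^bsub>L\<^esub> y"]
          O.le_trans[of "?a \<otimes>\<^bsub>L\<^esub> ?b" "y \<otimes>\<^bsub>L\<^esub> y" z] z split.prems
        by simp
      moreover have "lg_le L (seq_val L h \<Xi>) z" if "\<Xi> \<in> fset G" for \<Xi>
        using O.le_trans[of "seq_val L h \<Xi>" y z] z split.prems that by simp
      ultimately show "lg_le L \<one>\<^bsub>L\<^esub> z"
        using split.IH[of z] z by simp
    qed
  qed
qed

section \<open>Gordan's alternative for integer vectors\<close>

inductive_set semigroup_span :: "('v \<Rightarrow> int) set \<Rightarrow> ('v \<Rightarrow> int) set" for S where
  base: "s \<in> S \<Longrightarrow> s \<in> semigroup_span S"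
| add: "s \<in> semigroup_span S \<Longrightarrow> t \<in> semigroup_span S \<Longrightarrow> (\<lambda>x. s x + t x) \<in> semigroup_span S"

lemma semigroup_span_subset:
  assumes "T \<subseteq> semigroup_span S"
  shows "semigroup_span T \<subseteq> semigroup_span S"
proof
  fix s assume "s \<in> semigroup_span T"
  then show "s \<in> semigroup_span S"
    by induction (use assms in \<open>auto intro: semigroup_span.add\<close>)
qed

lemma semigroup_span_scale:
  assumes "s \<in> semigroup_span S" and "n > 0"
  shows "(\<lambda>x. n * s x) \<in> semigroup_span S"
  using \<open>n > 0\<close>
proof (induction n rule: int_gr_induct)
  case base
  then show ?case using assms by simp
next
  case (step n)
  then show ?case
    using semigroup_span.add[OF step.IH assms(1)] by (simp add: algebra_simps)
qed

text \<open>Supplies the value of the eliminated variable, strictly between its lower bounds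
  \<open>A\<close> and its upper bounds \<open>B\<close>.\<close>

lemma finite_sets_separated:
  fixes A B :: "'a :: {dense_linorder, no_top, no_bot} set"
  assumes "finite A" "finite B" and less: "\<And>a b. a \<in> A \<Longrightarrow> b \<in> B \<Longrightarrow> a < b"
  shows "\<exists>q. (\<forall>a\<in>A. a < q) \<and> (\<forall>b\<in>B. q < b)"
proof (cases "A = {} \<or> B = {}")
  case False
  then have "Max A < Min B" using assms by simp
  then obtain q where "Max A < q" "q < Min B" using dense by blast
  then show ?thesis using assms False by auto
next
  case True
  \<comment> \<open>Only one family of bounds can be present: \<open>l\<close> serves if
    \<open>A\<close> is empty, \<open>u\<close> otherwise.\<close>
  obtain u where "A \<noteq> {} \<Longrightarrow> Max A < u" using gt_ex by blast
  moreover obtain l where "B \<noteq> {} \<Longrightarrow> l < Min B" using lt_ex by blast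
  ultimately show ?thesis using assms True by (cases "A = {}") auto
qed

text \<open>Induction on the finite support \<open>V\<close>: coordinate \<open>v\<close> is
  eliminated, and a functional negative on the resulting vectors is extended by a suitable value
  \<open>q\<close> at \<open>v\<close>.\<close>

theorem gordan_alternative:
  fixes S :: "('v \<Rightarrow> int) set"
  assumes "finite V" "finite S" "\<And>s x. s \<in> S \<Longrightarrow> x \<notin> V \<Longrightarrow> s x = 0"
    and "(\<lambda>x. 0) \<notin> semigroup_span S"
  shows "\<exists>h :: 'v \<Rightarrow> rat. \<forall>s\<in>S. (\<Sum>x\<in>V. h x * of_int (s x)) < 0"
  using assms
proof (induction V arbitrary: S rule: finite_induct)
  case empty
  then have "s = (\<lambda>x. 0)" if "s \<in> S" for s using that by auto
  then have "S = {}" using empty.prems(3) semigroup_span.base by blast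
  then show ?case by simp
next
  case (insert v V)
  define P N where "P = {s \<in> S. s v > 0}" and "N = {s \<in> S. s v < 0}"
  \<comment> \<open>The combination of \<open>s\<close> and \<open>t\<close> that cancels coordinate
    \<open>v\<close>. For \<open>s\<close> in \<open>P\<close> and \<open>t\<close> in
    \<open>N\<close> both coefficients are positive, so it stays in the span of
    \<open>S\<close>.\<close>
  define elim where "elim = (\<lambda>(s, t) x. s v * t x + (- t v) * s x :: int)"
  define T where "T = {s \<in> S. s v = 0} \<union> elim ` (P \<times> N)"
  have fin: "finite P" "finite N" "finite T"
    using \<open>finite S\<close> by (simp_all add: P_def N_def T_def)
  have "elim (s, t) \<in> semigroup_span S" if "s \<in> P" "t \<in> N" for s t
    using that unfolding elim_def prod.case P_def N_def
    by (intro semigroup_span.add semigroup_span_scale) (auto intro: semigroup_span.base)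
  then have "T \<subseteq> semigroup_span S"
    by (auto simp: T_def intro: semigroup_span.base)
  then have "(\<lambda>x. 0) \<notin> semigroup_span T"
    using semigroup_span_subset insert.prems(3) by blast
  moreover have "s x = 0" if "s \<in> T" "x \<notin> V" for s x
  proof (cases "x = v")
    case True
    then show ?thesis using that by (auto simp: T_def elim_def P_def N_def)
  next
    case False
    then have zero: "t x = 0" if "t \<in> S" for t using that \<open>x \<notin> V\<close> insert.prems(2) by simp
    have "s \<in> S \<or> (\<exists>a b. a \<in> S \<and> b \<in> S \<and> s = elim (a, b))"
      using \<open>s \<in> T\<close> by (auto simp: T_def P_def N_def)
    then show ?thesis
    proof (elim disjE exE conjE)
      fix a b assume "a \<in> S" "b \<in> S" "s = elim (a, b)"
      then show ?thesis using zero[of a] zero[of b] by (simp add: elim_def)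
    qed (rule zero)
  qed
  ultimately obtain h :: "'v \<Rightarrow> rat" where h: "\<And>s. s \<in> T \<Longrightarrow> (\<Sum>x\<in>V. h x * of_int (s x)) < 0"
    using insert.IH[OF fin(3)] by blast
  define \<phi> where "\<phi> s = (\<Sum>x\<in>V. h x * of_int (s x))" for s :: "'v \<Rightarrow> int"
  have \<phi>_elim: "\<phi> (elim (s, t)) = of_int (s v) * \<phi> t - of_int (t v) * \<phi> s" for s t
    by (simp add: \<phi>_def elim_def sum_distrib_left sum_subtractf[symmetric] algebra_simps)
  \<comment> \<open>Solving \<open>q * s v + \<phi> s < 0\<close> for \<open>q\<close> gives a lower
    bound for each vector in \<open>N\<close> and an upper bound for each in
    \<open>P\<close>.\<close>
  have "\<exists>q. (\<forall>a\<in>(\<lambda>t. - \<phi> t / of_int (t v)) ` N. a < q) \<and>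
            (\<forall>b\<in>(\<lambda>s. - \<phi> s / of_int (s v)) ` P. q < b)"
  proof (rule finite_sets_separated)
    fix a b assume "a \<in> (\<lambda>t. - \<phi> t / of_int (t v)) ` N" "b \<in> (\<lambda>s. - \<phi> s / of_int (s v)) ` P"
    then obtain s t where st: "s \<in> P" "t \<in> N"
      "a = - \<phi> t / of_int (t v)" "b = - \<phi> s / of_int (s v)" by blast
    then have "elim (s, t) \<in> T" by (auto simp: T_def)
    \<comment> \<open>Dividing by the positive number \<open>s v * (- t v)\<close> turns this into
      \<open>a < b\<close>.\<close>
    then have "of_int (s v) * \<phi> t - of_int (t v) * \<phi> s < 0"
      using h[of "elim (s, t)"] \<phi>_elim[of s t] by (simp add: \<phi>_def)
    moreover have "(of_int (s v) :: rat) > 0" "(of_int (t v) :: rat) < 0"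
      using st by (simp_all add: P_def N_def)
    ultimately show "a < b"
      unfolding st by (simp add: field_simps)
  qed (use fin in auto)
  then obtain q where q: "\<And>t. t \<in> N \<Longrightarrow> - \<phi> t / of_int (t v) < q"
    "\<And>s. s \<in> P \<Longrightarrow> q < - \<phi> s / of_int (s v)" by auto
  have "(\<Sum>x\<in>insert v V. (h(v := q)) x * of_int (s x)) < 0" if "s \<in> S" for s
  proof -
    have "(\<Sum>x\<in>V. (h(v := q)) x * of_int (s x)) = \<phi> s"
      unfolding \<phi>_def using insert.hyps by (intro sum.cong) auto
    then have eq: "(\<Sum>x\<in>insert v V. (h(v := q)) x * of_int (s x)) = q * of_int (s v) + \<phi> s"
      using insert.hyps by simp
    consider "s v = 0" | "s v > 0" | "s v < 0" by linarith
    then have "q * of_int (s v) + \<phi> s < 0"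
    proof cases
      case 1
      then show ?thesis using h[of s] that by (simp add: T_def \<phi>_def)
    next
      case 2
      then have "q < - \<phi> s / of_int (s v)" using q(2)[of s] that by (simp add: P_def)
      then show ?thesis using 2 by (simp add: field_simps)
    next
      case 3
      then have "- \<phi> s / of_int (s v) < q" using q(1)[of s] that by (simp add: N_def)
      then show ?thesis using 3 by (simp add: field_simps)
    qed
    then show ?thesis using eq by simp
  qed
  then show ?case by blast
qed

section \<open>Derivability from a vanishing sum of net exponents\<close>

definition net_exponent :: "'v sequent \<Rightarrow> 'v \<Rightarrow> int" where
  "net_exponent \<Gamma> x = int (count (mset \<Gamma>) (Var x)) - int (count (mset \<Gamma>) (Inv x))"

lemma net_exponent_append:
  "net_exponent (\<Gamma> @ \<Delta>) = (\<lambda>x. net_exponent \<Gamma> x + net_exponent \<Delta> x)"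
  by (simp add: net_exponent_def fun_eq_iff)

text \<open>(ex) realises every permutation: the letters of the target are moved into place one at a
  time, the prefix \<open>\<Theta>\<close> holding those already placed.\<close>

lemma GA_permute:
  assumes "GA (finsert \<Gamma> G)" and "mset \<Gamma> = mset \<Delta>"
  shows "GA (finsert \<Delta> G)"
proof -
  have "GA (finsert (\<Theta> @ \<Delta>) G)" if "GA (finsert (\<Theta> @ \<Gamma>) G)" "mset \<Gamma> = mset \<Delta>" for \<Theta>
    using that
  proof (induction \<Delta> arbitrary: \<Theta> \<Gamma>)
    case Nil
    then show ?case by simp
  next
    case (Cons l \<Delta>)
    then have "l \<in> set \<Gamma>" by (metis list.set_intros(1) set_mset_mset)
    then obtain \<Gamma>1 \<Gamma>2 where \<Gamma>: "\<Gamma> = \<Gamma>1 @ l # \<Gamma>2" by (meson split_list)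
    \<comment> \<open>Exchanging \<open>\<Gamma>1\<close> with \<open>l # \<Gamma>2\<close> brings
      \<open>l\<close> directly behind the prefix.\<close>
    have "GA (finsert ((\<Theta> @ [l]) @ \<Gamma>2 @ \<Gamma>1) G)"
      using GA.ex[of \<Theta> \<Gamma>1 "l # \<Gamma>2" G] Cons.prems(1) by (simp add: \<Gamma>)
    moreover have "mset (\<Gamma>2 @ \<Gamma>1) = mset \<Delta>"
      using Cons.prems(2) by (simp add: \<Gamma> add.commute)
    ultimately show ?case using Cons.IH by fastforce
  qed
  from this[of "[]"] show ?thesis using assms by simp
qed

lemma GA_if_net_exponent_zero:
  assumes "net_exponent \<Gamma> = (\<lambda>x. 0)"
  shows "GA (finsert \<Gamma> G)"
proof -
  \<comment> \<open>The positive literals of \<open>\<Gamma>\<close>. As each variable occurs as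
    often as its inverse, \<open>\<Gamma>\<close> is a permutation of
    \<open>\<Delta> @ seq_inv \<Delta>\<close>.\<close>
  define \<Delta> where "\<Delta> = filter (\<lambda>l. \<exists>x. l = Var x) \<Gamma>"
  have inv: "count (mset (seq_inv \<Xi>)) l = count (mset \<Xi>) (lit_inv l)" for \<Xi> :: "'a sequent" and l
  proof (induction \<Xi>)
    case (Cons k \<Xi>)
    then show ?case by (cases k; cases l) (auto simp: seq_inv_def)
  qed (simp add: seq_inv_def)
  have "count (mset (\<Delta> @ seq_inv \<Delta>)) l = count (mset \<Gamma>) l" for l
    using fun_cong[OF assms] by (cases l) (auto simp: inv \<Delta>_def net_exponent_def)
  then have "mset (\<Delta> @ seq_inv \<Delta>) = mset \<Gamma>" by (intro multiset_eqI)
  with GA.id show ?thesis by (rule GA_permute)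
qed

text \<open>(split) detaches one sequent at a time, and each is absorbed by \<open>G\<close>. The
  list must be non-empty because the empty sequent is always derivable by (id).\<close>

lemma GA_if_GA_concat:
  assumes "GA (finsert (concat \<Gamma>s) G)" "\<Gamma>s \<noteq> []" "set \<Gamma>s \<subseteq> fset G"
  shows "GA G"
  using assms(2,1,3)
proof (induction \<Gamma>s rule: list_nonempty_induct)
  case (single \<Gamma>)
  then show ?case by (simp add: finsert_absorb)
next
  case (cons \<Gamma> \<Gamma>s)
  then have "GA (finsert \<Gamma> (finsert (concat \<Gamma>s) G))" by (auto intro: GA.split)
  then show ?case using cons by (simp add: finsert_commute[of \<Gamma>] finsert_absorb)
qed

lemma GA_if_zero_in_semigroup_span:
  assumes "(\<lambda>x. 0) \<in> semigroup_span (net_exponent ` fset G)"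
  shows "GA G"
proof -
  \<comment> \<open>Sums of vectors lift to concatenations of members of \<open>G\<close>;
    repetitions in the list record multiplicities.\<close>
  have "\<exists>\<Gamma>s. \<Gamma>s \<noteq> [] \<and> set \<Gamma>s \<subseteq> fset G \<and> net_exponent (concat \<Gamma>s) = s"
    if "s \<in> semigroup_span (net_exponent ` fset G)" for s
    using that
  proof induction
    case (base s)
    then obtain \<Gamma> where "\<Gamma> \<in> fset G" "s = net_exponent \<Gamma>" by blast
    then show ?case by (intro exI[of _ "[\<Gamma>]"]) simp
  next
    case (add s t)
    then obtain \<Gamma>s \<Delta>s where "\<Gamma>s \<noteq> []" "set \<Gamma>s \<subseteq> fset G" "net_exponent (concat \<Gamma>s) = s"
      "set \<Delta>s \<subseteq> fset G" "net_exponent (concat \<Delta>s) = t" by blast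
    then show ?case
      by (intro exI[of _ "\<Gamma>s @ \<Delta>s"]) (auto simp: net_exponent_append)
  qed
  from this[OF assms] obtain \<Gamma>s
    where "\<Gamma>s \<noteq> []" "set \<Gamma>s \<subseteq> fset G" "net_exponent (concat \<Gamma>s) = (\<lambda>x. 0)" by blast
  then show ?thesis using GA_if_GA_concat[OF GA_if_net_exponent_zero] by blast
qed

section \<open>A copy of the ordered group of rationals\<close>

text \<open>The rationals are transported along an injection \<open>f\<close>, because the carrier
  has to consist of elements of the given type \<open>'g\<close>.\<close>

definition rat_lgroup :: "(rat \<Rightarrow> 'g) \<Rightarrow> 'g lgroup" where
  "rat_lgroup f = \<lparr>carrier = range f, monoid.mult = (\<lambda>a b. f (the_inv f a + the_inv f b)), one = f 0,
     lg_le = (\<lambda>a b. the_inv f a \<le> the_inv f b)\<rparr>"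

context
  fixes f :: "rat \<Rightarrow> 'g"
  assumes inj: "inj f"
begin

lemma rat_lgroup_simps:
  "carrier (rat_lgroup f) = range f" "f a \<otimes>\<^bsub>rat_lgroup f\<^esub> f b = f (a + b)"
  "\<one>\<^bsub>rat_lgroup f\<^esub> = f 0" "lg_le (rat_lgroup f) (f a) (f b) \<longleftrightarrow> a \<le> b"
  by (simp_all add: rat_lgroup_def the_inv_f_f[OF inj])

lemma comm_group_rat_lgroup: "comm_group (rat_lgroup f)"
proof (rule comm_groupI)
  fix x assume "x \<in> carrier (rat_lgroup f)"
  then obtain a where "x = f a" by (auto simp: rat_lgroup_simps)
  then have "f (- a) \<otimes>\<^bsub>rat_lgroup f\<^esub> x = \<one>\<^bsub>rat_lgroup f\<^esub>" by (simp add: rat_lgroup_simps)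
  then show "\<exists>y\<in>carrier (rat_lgroup f). y \<otimes>\<^bsub>rat_lgroup f\<^esub> x = \<one>\<^bsub>rat_lgroup f\<^esub>"
    by (auto simp: rat_lgroup_simps)
qed (auto simp: rat_lgroup_simps add_ac)

lemma rat_lgroup_inv: "inv\<^bsub>rat_lgroup f\<^esub> f a = f (- a)"
proof -
  interpret comm_group "rat_lgroup f" by (rule comm_group_rat_lgroup)
  show ?thesis by (rule inv_equality) (simp_all add: rat_lgroup_simps)
qed

lemma rat_lgroup_in_abelian_lgroups: "rat_lgroup f \<in> abelian_lgroups"
proof -
  interpret comm_group "rat_lgroup f" by (rule comm_group_rat_lgroup)
  \<comment> \<open>A total order is a lattice, so joins and meets need not be exhibited.\<close>
  interpret O: total_order "lg_order (rat_lgroup f)"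
    by unfold_locales (auto simp: rat_lgroup_simps)
  show ?thesis
    using O.lattice_axioms is_group comm_group_rat_lgroup
    by (auto simp: abelian_lgroups_def is_lgroup_def rat_lgroup_simps)
qed

text \<open>Links semantics to linear algebra: an assignment \<open>h\<close> acts on sequents as a
  linear functional on their net exponents.\<close>

lemma seq_val_rat_lgroup:
  assumes "finite V" and "\<And>x. Var x \<in> set \<Gamma> \<or> Inv x \<in> set \<Gamma> \<Longrightarrow> x \<in> V"
  shows "seq_val (rat_lgroup f) (\<lambda>x. f (h x)) \<Gamma> = f (\<Sum>x\<in>V. h x * of_int (net_exponent \<Gamma> x))"
  using assms(2)
proof (induction \<Gamma>)
  case Nil
  then show ?case by (simp add: rat_lgroup_simps net_exponent_def)
next
  case (Cons l \<Gamma>)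
  have IH: "seq_val (rat_lgroup f) (\<lambda>x. f (h x)) \<Gamma> =
      f (\<Sum>x\<in>V. h x * of_int (net_exponent \<Gamma> x))"
    by (rule Cons.IH) (use Cons.prems in auto)
  show ?case
  proof (cases l)
    case (Var y)
    then have "net_exponent (l # \<Gamma>) x =
        (if x = y then 1 + net_exponent \<Gamma> x else net_exponent \<Gamma> x)" for x
      by (simp add: net_exponent_def)
    moreover have "y \<in> V" using Cons.prems Var by auto
    ultimately show ?thesis
      by (simp add: Var IH rat_lgroup_simps sum.remove[OF \<open>finite V\<close> \<open>y \<in> V\<close>] distrib_left
          add.assoc)
  next
    case (Inv y)
    then have "net_exponent (l # \<Gamma>) x =
        (if x = y then - 1 + net_exponent \<Gamma> x else net_exponent \<Gamma> x)" for x
      by (simp add: net_exponent_def)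
    moreover have "y \<in> V" using Cons.prems Inv by auto
    ultimately show ?thesis
      by (simp add: Inv IH rat_lgroup_simps rat_lgroup_inv sum.remove[OF \<open>finite V\<close> \<open>y \<in> V\<close>]
          algebra_simps)
  qed
qed

lemma GA_complete_rat_lgroup:
  fixes G :: "'v hypersequent"
  assumes valid: "valid_in {rat_lgroup f} G" and "G \<noteq> {||}"
  shows "GA G"
proof (rule ccontr)
  assume "\<not> GA G"
  then have zero: "(\<lambda>x. 0) \<notin> semigroup_span (net_exponent ` fset G)"
    using GA_if_zero_in_semigroup_span by blast
  define var :: "'v literal \<Rightarrow> 'v" where "var l = (case l of Var x \<Rightarrow> x | Inv x \<Rightarrow> x)" for l
  define V where "V = (\<Union>\<Gamma>\<in>fset G. var ` set \<Gamma>)"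
  have V: "x \<in> V" if "\<Gamma> \<in> fset G" "Var x \<in> set \<Gamma> \<or> Inv x \<in> set \<Gamma>" for \<Gamma> x
    using that unfolding V_def var_def by force
  have "finite V" by (simp add: V_def)
  moreover have "s x = 0" if "s \<in> net_exponent ` fset G" "x \<notin> V" for s x
  proof -
    obtain \<Gamma> where "\<Gamma> \<in> fset G" "s = net_exponent \<Gamma>" using \<open>s \<in> _\<close> by blast
    moreover from this have "Var x \<notin> set \<Gamma>" "Inv x \<notin> set \<Gamma>" using V \<open>x \<notin> V\<close> by blast+
    ultimately show ?thesis by (simp add: net_exponent_def not_in_iff[THEN iffD1])
  qed
  ultimately obtain h :: "'v \<Rightarrow> rat"
    where h: "\<And>\<Gamma>. \<Gamma> \<in> fset G \<Longrightarrow> (\<Sum>x\<in>V. h x * of_int (net_exponent \<Gamma> x)) < 0"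
    using gordan_alternative[of V "net_exponent ` fset G"] zero by auto
  let ?L = "rat_lgroup f" and ?v = "\<lambda>\<Gamma>. \<Sum>x\<in>V. h x * of_int (net_exponent \<Gamma> x)"
  \<comment> \<open>The largest value of a sequent under \<open>h\<close> is negative, yet
    \<open>f m\<close> is an upper bound, so validity would force \<open>0 \<le> m\<close>.\<close>
  define m where "m = Max (?v ` fset G)"
  have "?v ` fset G \<noteq> {}" using \<open>G \<noteq> {||}\<close> by (auto simp: fset_eq_iff)
  then have "m < 0" using h by (simp add: m_def)
  have "lg_le ?L (seq_val ?L (\<lambda>x. f (h x)) \<Gamma>) (f m)" if "\<Gamma> \<in> fset G" for \<Gamma>
  proof -
    have "seq_val ?L (\<lambda>x. f (h x)) \<Gamma> = f (?v \<Gamma>)"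
      using seq_val_rat_lgroup[OF \<open>finite V\<close>] V that by blast
    then show ?thesis using that by (simp add: rat_lgroup_simps m_def)
  qed
  moreover have "lg_le ?L \<one>\<^bsub>?L\<^esub> (hseq_val ?L (\<lambda>x. f (h x)) G)"
    using valid by (simp add: valid_in_def rat_lgroup_simps)
  ultimately have "lg_le ?L \<one>\<^bsub>?L\<^esub> (f m)"
    using one_le_hseq_val_iff[of ?L "\<lambda>x. f (h x)" G] rat_lgroup_in_abelian_lgroups \<open>G \<noteq> {||}\<close>
    by (simp add: rat_lgroup_simps abelian_lgroups_def)
  then show False using \<open>m < 0\<close> by (simp add: rat_lgroup_simps)
qed

end

theorem theorem3:
  fixes G :: "'v hypersequent"
  assumes "infinite (UNIV :: 'g set)"
    and "G \<noteq> {||}"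
  shows "valid_in (abelian_lgroups :: 'g lgroup set) G \<longleftrightarrow> GA G"
proof
  obtain g :: "nat \<Rightarrow> 'g" where "inj g"
    using infinite_countable_subset[OF assms(1)] by blast
  \<comment> \<open>An infinite type contains a copy of the naturals, hence of the countable set of
    rationals.\<close>
  then have inj: "inj (g \<circ> (to_nat :: rat \<Rightarrow> nat))" by (simp add: inj_compose)
  assume "valid_in (abelian_lgroups :: 'g lgroup set) G"
  then have "valid_in {rat_lgroup (g \<circ> to_nat)} G"
    using rat_lgroup_in_abelian_lgroups[OF inj] by (simp add: valid_in_def)
  then show "GA G" using GA_complete_rat_lgroup[OF inj] assms(2) by blast
next
  assume "GA G"
  show "valid_in (abelian_lgroups :: 'g lgroup set) G"
    unfolding valid_in_def lg_order_simps
  proof (intro ballI allI impI)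
    fix L :: "'g lgroup" and h :: "'v \<Rightarrow> 'g"
    assume "L \<in> abelian_lgroups" and h: "\<forall>x. h x \<in> carrier L"
    then have "is_lgroup L" "comm_group L" by (simp_all add: abelian_lgroups_def)
    then show "lg_le L \<one>\<^bsub>L\<^esub> (hseq_val L h G)"
      using one_le_hseq_val_iff[of L h G] GA_sound[OF \<open>GA G\<close>, of L h] h assms(2) by blast
  qed
qed

end
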